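(* Let $A$ and $B$ be finite sets of real numbers with $|A| = k$ and $|B| = \ell$. Write $A=\{a_1,a_2,\ldots,a_k\}$ with $a_1<a_2<\cdots<a_k$, and suppose that $A$ has distinct consecutive differences, i.e. for $1\le i,j\le k-1$, $a_{i+1}-a_i=a_{j+1}-a_j$ implies $i=j$. Then \[ |A+B| \geq \frac{k\sqrt{\ell}}{3}. \] In particular, if $k=\ell$, then $|A+B|\geq \frac{k^{3/2}}{3}$.
   Context: For sets of real numbers $A,B$, the sumset is $A+B=\{a+b : a\in A,\ b\in B\}$. *)

theory Defs
  imports Complex_Main "HOL-Library.Set_Algebras"
begin

end

theory Submission imports Defs begin

text \<open>
  Replace each element of \<open>S = A + B\<close> by its rank in \<open>S\<close>. For \<open>b \<in> B\<close> the ranks of the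
  \<open>a\<^sub>i + b\<close> increase with \<open>i\<close>, so their consecutive gaps add up to at most \<open>|S|\<close>; over all \<open>b\<close> the
  total gap is at most \<open>\<ell>|S|\<close>. On the other hand the pair \<open>(a\<^sub>i + b, a\<^sub>i\<^sub>+\<^sub>1 + b)\<close> determines its
  difference, hence \<open>i\<close>, hence \<open>b\<close>, so each gap value occurs at most \<open>|S|\<close> times among the
  \<open>N = \<ell>(k - 1)\<close> pairs, which forces the total gap to be at least \<open>N\<^sup>2 / (2|S|)\<close>. Therefore
  \<open>|S|\<^sup>2 \<ge> \<ell>(k - 1)\<^sup>2 / 2\<close>, and \<open>(k - 1)\<^sup>2 / 2 \<ge> k\<^sup>2 / 9\<close> for \<open>k \<ge> 2\<close>.
\<close>

text \<open>Each value of \<open>g\<close> is taken at most \<open>s\<close> times, so small values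
  cannot dominate. For a threshold \<open>d\<close>, the positive parts of \<open>d - g p\<close>
  sum to at most \<open>s * d * (d - 1) / 2\<close>, which bounds the sum of \<open>g\<close> from
  below; \<open>d\<close> is then optimised.\<close>

lemma card_squared_le_sum_of_inj_on_pair:
  fixes f g :: "'a \<Rightarrow> nat"
  assumes fin: "finite P" and inj: "inj_on (\<lambda>p. (f p, g p)) P"
    and f: "\<And>p. p \<in> P \<Longrightarrow> f p < s" and g: "\<And>p. p \<in> P \<Longrightarrow> 1 \<le> g p"
  shows "(real (card P))\<^sup>2 \<le> 2 * real s * (\<Sum>p\<in>P. real (g p))"
proof (cases "P = {}")
  case False
  then have s: "0 < s"
    using f by fastforce
  define x where "x = real (card P) / real s"
  \<comment> \<open>The lower bound, divided by \<open>s\<close>, is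
    \<open>x * d - d * (d - 1) / 2\<close>, maximal over the reals at \<open>x + 1/2\<close>; this
    \<open>d\<close> is an integer in the interval from \<open>x\<close> to
    \<open>x + 1\<close>.\<close>
  define d where "d = Suc (nat \<lfloor>x\<rfloor>)"
  have x0: "0 \<le> x" by (simp add: x_def)
  have dx: "0 \<le> real d - x" "real d - x \<le> 1" "1 \<le> real d"
    using x0 unfolding d_def by linarith+
  have triangle: "(\<Sum>v = 1..n. real (n - v)) = real n * (real n - 1) / 2" for n
  proof (induction n)
    case (Suc n)
    have "(\<Sum>v = 1..Suc n. real (Suc n - v)) = (\<Sum>v = 1..n. real (n - v) + 1)"
      by (simp add: Suc_diff_le algebra_simps)
    then show ?case
      unfolding sum.distrib Suc by (simp add: field_simps)
  qed simp
  define Q where "Q = {p \<in> P. g p \<le> d}"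
  \<comment> \<open>On the right the subtraction is truncated, so points with \<open>g p > d\<close>
    contribute 0 instead of a negative amount.\<close>
  have "(\<Sum>p\<in>P. real d - real (g p)) \<le> (\<Sum>p\<in>P. real (d - g p))"
    by (intro sum_mono) linarith
  also have "\<dots> = (\<Sum>p\<in>Q. real (d - g p))"
    using fin by (intro sum.mono_neutral_right) (auto simp: Q_def)
  also have "\<dots> = (\<Sum>(u, v)\<in>(\<lambda>p. (f p, g p)) ` Q. real (d - v))"
    by (subst sum.reindex) (auto intro: inj_on_subset[OF inj] simp: Q_def)
  also have "\<dots> \<le> (\<Sum>(u, v)\<in>{..<s} \<times> {1..d}. real (d - v))"
    using f g by (intro sum_mono2) (auto simp: Q_def)
  also have "\<dots> = real s * (real d * (real d - 1) / 2)"
    by (simp only: sum.cartesian_product[symmetric] triangle sum_constant card_lessThan)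
  finally have le: "real (card P) * real d - real s * (real d * (real d - 1) / 2)
      \<le> (\<Sum>p\<in>P. real (g p))"
    by (simp add: sum_subtractf)
  have card: "real (card P) = real s * x"
    using s by (simp add: x_def)
  have "(real d - x)\<^sup>2 \<le> 1"
    using dx power_le_one[of "real d - x" 2] by simp
  \<comment> \<open>Rearranged, this says \<open>(d - x)^2 \<le> d\<close>, which holds because the
    square is at most 1 and \<open>1 \<le> d\<close>.\<close>
  then have "x\<^sup>2 / 2 \<le> x * real d - real d * (real d - 1) / 2"
    using dx by (simp add: power2_eq_square field_simps)
  then have "real s * (x\<^sup>2 / 2) \<le> real s * (x * real d - real d * (real d - 1) / 2)"
    by (rule mult_left_mono) simp
  also have "\<dots> \<le> (\<Sum>p\<in>P. real (g p))"
    using le by (simp add: card algebra_simps)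
  finally have "2 * real s * (real s * (x\<^sup>2 / 2)) \<le> 2 * real s * (\<Sum>p\<in>P. real (g p))"
    by (rule mult_left_mono) simp
  then show ?thesis
    by (simp add: card power2_eq_square algebra_simps)
qed simp

lemma rank_strict_mono_on:
  fixes S :: "'a::linorder set"
  assumes "finite S"
  shows "strict_mono_on S (\<lambda>x. card {y \<in> S. y < x})"
  using assms by (intro strict_mono_onI psubset_card_mono) auto

text \<open>The counting lemma is applied to \<open>card B * (k - 1)\<close> pairs whose gaps total
  at most \<open>card B * card S\<close>; one factor \<open>card B\<close> then cancels.\<close>

lemma card_sumset_squared_ge:
  fixes a :: "nat \<Rightarrow> real" and B :: "real set"
  assumes fin: "finite B" and k: "1 \<le> k" and mono: "strict_mono_on {1..k} a"
    and dist: "\<forall>i\<in>{1..<k}. \<forall>j\<in>{1..<k}. a (i + 1) - a i = a (j + 1) - a j \<longrightarrow> i = j"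
  shows "real (card B) * (real k - 1)\<^sup>2 \<le> 2 * (real (card (a ` {1..k} + B)))\<^sup>2"
proof (cases "B = {}")
  case False
  define S where "S = a ` {1..k} + B"
  have finS: "finite S"
    using fin by (simp add: S_def finite_set_plus)
  define r where "r x = card {y \<in> S. y < x}" for x
  have r_mono: "strict_mono_on S r"
    using rank_strict_mono_on[OF finS] by (simp add: r_def[abs_def])
  have r_less: "r x < card S" if "x \<in> S" for x
    unfolding r_def using finS that by (intro psubset_card_mono) auto
  have mem: "a i + b \<in> S" if "i \<in> {1..k}" "b \<in> B" for i b
    using that by (auto simp: S_def intro!: set_plus_intro)
  have step: "r (a i + b) < r (a (Suc i) + b)" if "i \<in> {1..<k}" "b \<in> B" for i b
  proof (rule strict_mono_onD[OF r_mono])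
    show "a i + b < a (Suc i) + b"
      using strict_mono_onD[OF mono, of i "Suc i"] that by simp
  qed (use that in \<open>auto intro!: mem\<close>)
  define P where "P = {1..<k} \<times> B"
  define f where "f = (\<lambda>(i, b). r (a i + b))"
  define g where "g = (\<lambda>(i, b). r (a (Suc i) + b) - r (a i + b))"
  have "inj_on (\<lambda>p. (f p, g p)) P"
  proof (rule inj_onI, clarsimp simp: P_def f_def g_def)
    fix i b j c
    assume ij: "Suc 0 \<le> i" "i < k" "Suc 0 \<le> j" "j < k" and bc: "b \<in> B" "c \<in> B"
      and req: "r (a i + b) = r (a j + c)"
      and geq: "r (a (Suc i) + b) - r (a j + c) = r (a (Suc j) + c) - r (a j + c)"
    \<comment> \<open>By \<open>step\<close> both gaps are positive, so neither natural subtraction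
      is truncated and equal gaps give equal upper ranks.\<close>
    have "r (a (Suc i) + b) = r (a (Suc j) + c)"
      using geq req step[of i b] step[of j c] ij bc by simp
    then have "a (Suc i) + b = a (Suc j) + c"
      using strict_mono_on_imp_inj_on[OF r_mono] ij bc by (auto dest!: inj_onD intro!: mem)
    moreover have "a i + b = a j + c"
      using req strict_mono_on_imp_inj_on[OF r_mono] ij bc by (auto dest!: inj_onD intro!: mem)
    ultimately show "i = j \<and> b = c"
      using dist[rule_format, of i j] ij by force
  qed
  then have "(real (card P))\<^sup>2 \<le> 2 * real (card S) * (\<Sum>p\<in>P. real (g p))"
    using fin by (rule_tac card_squared_le_sum_of_inj_on_pair[where f = f])
      (auto simp: P_def f_def g_def Suc_le_eq step intro!: r_less mem)
  also have "(\<Sum>p\<in>P. real (g p)) = (\<Sum>b\<in>B. \<Sum>i = 1..<k. real (g (i, b)))"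
    unfolding P_def by (subst sum.swap) (simp add: sum.cartesian_product)
  also have "\<dots> \<le> (\<Sum>b\<in>B. real (card S))"
  proof (rule sum_mono)
    fix b assume b: "b \<in> B"
    have "(\<Sum>i = 1..<k. real (g (i, b)))
        = (\<Sum>i = 1..<k. real (r (a (Suc i) + b)) - real (r (a i + b)))"
      using step[OF _ b] by (intro sum.cong) (auto simp: g_def of_nat_diff less_imp_le)
    also have "\<dots> = real (r (a k + b)) - real (r (a 1 + b))"
      using k by (intro sum_Suc_diff')
    also have "\<dots> \<le> real (card S)"
      using r_less[OF mem[of k b]] k b by simp
    finally show "(\<Sum>i = 1..<k. real (g (i, b))) \<le> real (card S)" .
  qed
  finally have "(real (card P))\<^sup>2 \<le> 2 * real (card S) * (real (card B) * real (card S))"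
    by (simp add: mult_left_mono)
  moreover have "real (card P) = real (card B) * (real k - 1)"
    using k by (simp add: P_def card_cartesian_product of_nat_diff)
  ultimately have "real (card B) * (real (card B) * (real k - 1)\<^sup>2)
      \<le> real (card B) * (2 * (real (card S))\<^sup>2)"
    by (simp add: power2_eq_square algebra_simps)
  then show ?thesis
    using False fin unfolding S_def by (simp add: mult_le_cancel_left card_gt_0_iff)
qed simp

theorem theorem1:
  fixes A B :: "real set" and k l :: nat and a :: "nat \<Rightarrow> real"
  assumes "finite A" and "finite B"
    and "card A = k" and "card B = l"
    and "A = a ` {1..k}" and "strict_mono_on {1..k} a"
    and "\<forall>i\<in>{1..<k}. \<forall>j\<in>{1..<k}. a (i + 1) - a i = a (j + 1) - a j \<longrightarrow> i = j"
  shows "real (card (A + B)) \<ge> real k * sqrt (real l) / 3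
    \<and> (k = l \<longrightarrow> real (card (A + B)) \<ge> real k powr (3 / 2) / 3)"
proof -
  have bound: "real k * sqrt (real l) / 3 \<le> real (card (A + B))"
  \<comment> \<open>For \<open>k = 1\<close> the factor \<open>k - 1\<close> makes the squared bound
    trivial; there \<open>A + B\<close> is a translate of \<open>B\<close>.\<close>
  proof (cases "k < 2")
    case True
    then consider "k = 0" | "k = 1" by linarith
    then show ?thesis
    proof cases
      case 2
      then have "A + B = (+) (a 1) ` B"
        using assms by (auto simp: set_plus_def)
      then have "card (A + B) = l"
        using assms by (simp add: card_image)
      moreover have "sqrt (real l) \<le> real l"
        by (cases "l = 0") (auto intro!: real_le_lsqrt simp: power2_eq_square)
      moreover have "0 \<le> sqrt (real l)" by simp
      ultimately show ?thesis using 2 by simp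
    qed simp
  next
    case False
    have "real l * (real k - 1)\<^sup>2 \<le> 2 * (real (card (A + B)))\<^sup>2"
      using card_sumset_squared_ge[OF assms(2) _ assms(6,7)] False assms(4,5) by simp
    moreover have "real l * (2 * (real k)\<^sup>2) \<le> real l * (9 * (real k - 1)\<^sup>2)"
    proof (rule mult_left_mono)
      \<comment> \<open>The product is \<open>9 * (k - 1)^2 - 2 * k^2 - 1\<close>.\<close>
      have "0 \<le> (real k - 2) * (7 * real k - 4)"
        using False by (intro mult_nonneg_nonneg) auto
      then show "2 * (real k)\<^sup>2 \<le> 9 * (real k - 1)\<^sup>2"
        by (simp add: power2_eq_square algebra_simps)
    qed simp
    ultimately have "(real k * sqrt (real l) / 3)\<^sup>2 \<le> (real (card (A + B)))\<^sup>2"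
      by (simp add: power_mult_distrib power_divide algebra_simps)
    then show ?thesis
      by (rule power2_le_imp_le) simp
  qed
  moreover have "real k * sqrt (real k) = real k powr (3 / 2)"
    using powr_add[of "real k" 1 "1 / 2"] by (simp add: powr_half_sqrt)
  ultimately show ?thesis by auto
qed

end
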